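(* Let $S$ be a strongly subtractive semiring, i.e. a semiring in which every ideal is strong. Then the lattice $(\mathrm{Id}(S),+,\cap)$ of all ideals of $S$ (with join $I+J$ and meet $I\cap J$) is distributive.
   Context: A semiring is a commutative semiring $(S,+,0,\cdot,1)$ with multiplicative identity $1$ and additive identity $0$ that is absorbing ($a\cdot 0=0$ for all $a$). An ideal is a nonempty subset closed under addition and under multiplication by elements of $S$ ($S$ itself is allowed). $I+J=\{x+y: x\in I,y\in J\}$. An ideal $I$ is strong if, for all $a,b\in S$, $a+b\in I$ implies $a\in I$ and $b\in I$. $\mathrm{Id}(S)$ is the set of all ideals of $S$. *)

theory Defs
  imports "HOL-Algebra.AbelCoset" "HOL-Algebra.Lattice"
begin

text \<open>
  The locale \<^locale>\<open>semiring\<close> of HOL-Algebra has an absorbing zero and a multiplicative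
  identity, and does not require them to be distinct; only commutativity of the
  multiplication has to be added.
\<close>

locale commutative_semiring = semiring R + comm_monoid R for R (structure)

text \<open>
  The library locale \<open>ideal\<close> presupposes a ring and closure under additive inverses,
  so ideals of semirings are introduced here. The whole carrier is an ideal.
\<close>

definition semiring_ideal :: "('a, 'm) ring_scheme \<Rightarrow> 'a set \<Rightarrow> bool" where
  "semiring_ideal R I \<longleftrightarrow>
     I \<subseteq> carrier R \<and> I \<noteq> {} \<and>
     (\<forall>x\<in>I. \<forall>y\<in>I. x \<oplus>\<^bsub>R\<^esub> y \<in> I) \<and>
     (\<forall>s\<in>carrier R. \<forall>x\<in>I. s \<otimes>\<^bsub>R\<^esub> x \<in> I)"

definition strong :: "('a, 'm) ring_scheme \<Rightarrow> 'a set \<Rightarrow> bool" where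
  "strong R I \<longleftrightarrow>
     (\<forall>a\<in>carrier R. \<forall>b\<in>carrier R. a \<oplus>\<^bsub>R\<^esub> b \<in> I \<longrightarrow> a \<in> I \<and> b \<in> I)"

locale strongly_subtractive_semiring = commutative_semiring +
  assumes ideal_strong: "semiring_ideal R I \<Longrightarrow> strong R I"

definition ideals :: "('a, 'm) ring_scheme \<Rightarrow> 'a set set" where
  "ideals R = {I. semiring_ideal R I}"

definition ideal_order :: "('a, 'm) ring_scheme \<Rightarrow> 'a set gorder" where
  "ideal_order R = \<lparr>carrier = ideals R, eq = (=), le = (\<subseteq>)\<rparr>"

locale distributive_lattice = lattice +
  assumes meet_join_distrib:
    "\<lbrakk>x \<in> carrier L; y \<in> carrier L; z \<in> carrier L\<rbrakk>
       \<Longrightarrow> x \<sqinter> (y \<squnion> z) = (x \<sqinter> y) \<squnion> (x \<sqinter> z)"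

end

theory Submission
  imports Defs
begin

text \<open>Ideals ordered by inclusion form a lattice over any commutative semiring: an
  intersection of two ideals is an ideal, and \<open>I + J\<close> is the smallest ideal containing
  both, since each summand embeds by adding zero and any ideal above both is closed under sums
  (\<open>least_set_add\<close>, \<open>greatest_Int\<close>).

  Distributivity then reduces to an identity of sets, \<open>Int_set_add_distrib\<close>. Let x = j
  + k lie in I, with j in J and k in K. In general j and k may both lie outside I, but a strong I
  contains them both, so the same decomposition already exhibits x as a member of (I \<inter> J) +
  (I \<inter> K). The opposite inclusion holds for arbitrary ideals.\<close>

context semiring
begin

lemma ideal_subset_carrier: "semiring_ideal R I \<Longrightarrow> I \<subseteq> carrier R"
  by (simp add: semiring_ideal_def)

text \<open>Absorption sends any element of the nonempty set I to zero. Zero is then a common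
  element of any two ideals, which makes intersections nonempty, and the missing summand when I or J
  is embedded in I + J.\<close>

lemma zero_in_ideal:
  assumes "semiring_ideal R I"
  shows "\<zero> \<in> I"
proof -
  obtain x where "x \<in> I" "x \<in> carrier R"
    using assms by (auto simp: semiring_ideal_def)
  moreover have "\<zero> \<otimes> x \<in> I"
    using assms \<open>x \<in> I\<close> zero_closed unfolding semiring_ideal_def by blast
  ultimately show ?thesis by simp
qed

lemma ideal_Int:
  assumes "semiring_ideal R I" "semiring_ideal R J"
  shows "semiring_ideal R (I \<inter> J)"
proof -
  have "\<zero> \<in> I \<inter> J"
    using assms by (simp add: zero_in_ideal)
  moreover have "I \<inter> J \<subseteq> carrier R"
    using ideal_subset_carrier[OF assms(1)] by blast
  ultimately show ?thesis
    using assms unfolding semiring_ideal_def by blast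
qed

lemma mem_set_add_iff: "x \<in> I <+>\<^bsub>R\<^esub> J \<longleftrightarrow> (\<exists>i\<in>I. \<exists>j\<in>J. x = i \<oplus> j)"
  by (simp add: set_add_def')

lemma ideal_set_add:
  assumes I: "semiring_ideal R I" and J: "semiring_ideal R J"
  shows "semiring_ideal R (I <+>\<^bsub>R\<^esub> J)"
proof -
  note sub = subsetD[OF ideal_subset_carrier[OF I]] subsetD[OF ideal_subset_carrier[OF J]]
  have "I <+>\<^bsub>R\<^esub> J \<subseteq> carrier R"
    by (auto simp: mem_set_add_iff sub)
  moreover have "I <+>\<^bsub>R\<^esub> J \<noteq> {}"
    using zero_in_ideal[OF I] zero_in_ideal[OF J] mem_set_add_iff by blast
  moreover have "x \<oplus> y \<in> I <+>\<^bsub>R\<^esub> J" if xy: "x \<in> I <+>\<^bsub>R\<^esub> J" "y \<in> I <+>\<^bsub>R\<^esub> J" for x y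
  proof -
    obtain i j i' j' where ij: "i \<in> I" "j \<in> J" "i' \<in> I" "j' \<in> J"
      and eq: "x = i \<oplus> j" "y = i' \<oplus> j'"
      using xy by (auto simp: mem_set_add_iff)
    have "x \<oplus> y = (i \<oplus> i') \<oplus> (j \<oplus> j')"
      using ij by (simp add: eq sub a_ac)
    moreover have "i \<oplus> i' \<in> I" "j \<oplus> j' \<in> J"
      using ij I J by (auto simp: semiring_ideal_def)
    ultimately show ?thesis
      by (auto simp: mem_set_add_iff)
  qed
  moreover have "s \<otimes> x \<in> I <+>\<^bsub>R\<^esub> J" if s: "s \<in> carrier R" and x: "x \<in> I <+>\<^bsub>R\<^esub> J" for s x
  proof -
    obtain i j where ij: "i \<in> I" "j \<in> J" and eq: "x = i \<oplus> j"
      using x by (auto simp: mem_set_add_iff)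
    have "s \<otimes> x = s \<otimes> i \<oplus> s \<otimes> j"
      using ij s by (simp add: eq sub r_distr)
    moreover have "s \<otimes> i \<in> I" "s \<otimes> j \<in> J"
      using ij s I J by (auto simp: semiring_ideal_def)
    ultimately show ?thesis
      by (auto simp: mem_set_add_iff)
  qed
  ultimately show ?thesis
    by (simp add: semiring_ideal_def)
qed

lemma set_add_upper:
  assumes I: "semiring_ideal R I" and J: "semiring_ideal R J"
  shows "I \<subseteq> I <+>\<^bsub>R\<^esub> J" "J \<subseteq> I <+>\<^bsub>R\<^esub> J"
proof -
  note sub = subsetD[OF ideal_subset_carrier[OF I]] subsetD[OF ideal_subset_carrier[OF J]]
  have "x \<in> I <+>\<^bsub>R\<^esub> J" if "x \<in> I" for x
    using that zero_in_ideal[OF J] r_zero[of x] sub(1) unfolding mem_set_add_iff by metis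
  then show "I \<subseteq> I <+>\<^bsub>R\<^esub> J" by blast
  have "x \<in> I <+>\<^bsub>R\<^esub> J" if "x \<in> J" for x
    using that zero_in_ideal[OF I] l_zero[of x] sub(2) unfolding mem_set_add_iff by metis
  then show "J \<subseteq> I <+>\<^bsub>R\<^esub> J" by blast
qed

lemma set_add_least:
  assumes "semiring_ideal R K" "I \<subseteq> K" "J \<subseteq> K"
  shows "I <+>\<^bsub>R\<^esub> J \<subseteq> K"
proof
  fix x assume "x \<in> I <+>\<^bsub>R\<^esub> J"
  then obtain i j where "i \<in> I" "j \<in> J" "x = i \<oplus> j"
    by (auto simp: mem_set_add_iff)
  then show "x \<in> K"
    using assms unfolding semiring_ideal_def by blast
qed

lemma carrier_ideal_order: "carrier (ideal_order R) = {I. semiring_ideal R I}"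
  by (simp add: ideal_order_def ideals_def)

lemma le_ideal_order: "I \<sqsubseteq>\<^bsub>ideal_order R\<^esub> J \<longleftrightarrow> I \<subseteq> J"
  by (simp add: ideal_order_def)

text \<open>Phrased with \<open>least\<close> and \<open>Upper\<close> to serve twice: as the
  existence of joins in the lattice axioms, and as the characterization from which the join is
  computed.\<close>

lemma least_set_add:
  assumes "semiring_ideal R I" "semiring_ideal R J"
  shows "least (ideal_order R) (I <+>\<^bsub>R\<^esub> J) (Upper (ideal_order R) {I, J})"
proof (rule least_UpperI)
  fix K assume "K \<in> Upper (ideal_order R) {I, J}"
  then have "semiring_ideal R K" "I \<subseteq> K" "J \<subseteq> K"
    using assms unfolding Upper_def carrier_ideal_order le_ideal_order by blast+
  then show "I <+>\<^bsub>R\<^esub> J \<sqsubseteq>\<^bsub>ideal_order R\<^esub> K"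
    unfolding le_ideal_order by (rule set_add_least)
next
  fix K assume "K \<in> {I, J}"
  then show "K \<sqsubseteq>\<^bsub>ideal_order R\<^esub> I <+>\<^bsub>R\<^esub> J"
    unfolding le_ideal_order using set_add_upper[OF assms] by blast
qed (simp_all add: assms carrier_ideal_order ideal_set_add)

lemma greatest_Int:
  assumes "semiring_ideal R I" "semiring_ideal R J"
  shows "greatest (ideal_order R) (I \<inter> J) (Lower (ideal_order R) {I, J})"
proof (rule greatest_LowerI)
  fix K assume "K \<in> Lower (ideal_order R) {I, J}"
  then show "K \<sqsubseteq>\<^bsub>ideal_order R\<^esub> I \<inter> J"
    using assms unfolding Lower_def carrier_ideal_order le_ideal_order by blast
next
  fix K assume "K \<in> {I, J}"
  then show "I \<inter> J \<sqsubseteq>\<^bsub>ideal_order R\<^esub> K"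
    unfolding le_ideal_order by blast
qed (simp_all add: assms carrier_ideal_order ideal_Int)

lemma lattice_ideal_order: "lattice (ideal_order R)"
proof unfold_locales
  fix I J assume "I \<in> carrier (ideal_order R)" "J \<in> carrier (ideal_order R)"
  then have "semiring_ideal R I" "semiring_ideal R J"
    by (simp_all add: carrier_ideal_order)
  then show "\<exists>s. least (ideal_order R) s (Upper (ideal_order R) {I, J})"
    and "\<exists>s. greatest (ideal_order R) s (Lower (ideal_order R) {I, J})"
    using least_set_add greatest_Int by blast+
qed (auto simp: ideal_order_def)

text \<open>The join is by definition a \<open>SOME\<close>-choice among least upper bounds.
  Antisymmetry makes the least upper bound unique, so the choice can only be the sum of
  ideals.\<close>

lemma join_ideal_order:
  assumes "semiring_ideal R I" "semiring_ideal R J"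
  shows "I \<squnion>\<^bsub>ideal_order R\<^esub> J = I <+>\<^bsub>R\<^esub> J"
proof -
  interpret L: lattice "ideal_order R" by (rule lattice_ideal_order)
  show ?thesis
    unfolding join_def sup_def
    using least_set_add[OF assms]
    by (rule some_equality) (rule L.least_unique[OF _ least_set_add[OF assms]])
qed

lemma meet_ideal_order:
  assumes "semiring_ideal R I" "semiring_ideal R J"
  shows "I \<sqinter>\<^bsub>ideal_order R\<^esub> J = I \<inter> J"
proof -
  interpret L: lattice "ideal_order R" by (rule lattice_ideal_order)
  show ?thesis
    unfolding meet_def inf_def
    using greatest_Int[OF assms]
    by (rule some_equality) (rule L.greatest_unique[OF _ greatest_Int[OF assms]])
qed

end

context strongly_subtractive_semiring
begin

lemma Int_set_add_distrib:
  assumes I: "semiring_ideal R I" and J: "semiring_ideal R J" and K: "semiring_ideal R K"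
  shows "I \<inter> (J <+>\<^bsub>R\<^esub> K) = (I \<inter> J) <+>\<^bsub>R\<^esub> (I \<inter> K)"
proof
  show "I \<inter> (J <+>\<^bsub>R\<^esub> K) \<subseteq> (I \<inter> J) <+>\<^bsub>R\<^esub> (I \<inter> K)"
  proof
    fix x assume x: "x \<in> I \<inter> (J <+>\<^bsub>R\<^esub> K)"
    then obtain j k where jk: "j \<in> J" "k \<in> K" "x = j \<oplus> k"
      by (auto simp: mem_set_add_iff)
    moreover have "j \<in> carrier R" "k \<in> carrier R"
      using jk ideal_subset_carrier[OF J] ideal_subset_carrier[OF K] by auto
    \<comment> \<open>The only use of strongness: a sum in \<open>I\<close> has both summands in \<open>I\<close>.\<close>
    ultimately have "j \<in> I" "k \<in> I"
      using x ideal_strong[OF I] unfolding strong_def by blast+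
    with jk show "x \<in> (I \<inter> J) <+>\<^bsub>R\<^esub> (I \<inter> K)"
      by (auto simp: mem_set_add_iff)
  qed
  \<comment> \<open>Both intersections lie in the ideal I and in the ideal J + K, hence so does
    their sum.\<close>
  show "(I \<inter> J) <+>\<^bsub>R\<^esub> (I \<inter> K) \<subseteq> I \<inter> (J <+>\<^bsub>R\<^esub> K)"
    using set_add_least[OF I, of "I \<inter> J" "I \<inter> K"] set_add_upper[OF J K]
      set_add_least[OF ideal_set_add[OF J K], of "I \<inter> J" "I \<inter> K"] by blast
qed

lemma distributive_lattice_ideal_order: "distributive_lattice (ideal_order R)"
proof (intro distributive_lattice.intro distributive_lattice_axioms.intro lattice_ideal_order)
  fix I J K
  assume "I \<in> carrier (ideal_order R)" "J \<in> carrier (ideal_order R)" "K \<in> carrier (ideal_order R)"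
  then have "semiring_ideal R I" "semiring_ideal R J" "semiring_ideal R K"
    by (simp_all add: carrier_ideal_order)
  then show "I \<sqinter>\<^bsub>ideal_order R\<^esub> (J \<squnion>\<^bsub>ideal_order R\<^esub> K) =
      (I \<sqinter>\<^bsub>ideal_order R\<^esub> J) \<squnion>\<^bsub>ideal_order R\<^esub> (I \<sqinter>\<^bsub>ideal_order R\<^esub> K)"
    \<comment> \<open>The closure lemmas \<open>ideal_set_add\<close> and \<open>ideal_Int\<close>
      are what allow the outer lattice operations to be rewritten, as their arguments are themselves
      sums or intersections.\<close>
    by (simp add: join_ideal_order meet_ideal_order ideal_set_add ideal_Int Int_set_add_distrib)
qed

end

theorem theorem3p5:
  fixes S :: "('a, 'm) ring_scheme"
  assumes "strongly_subtractive_semiring S"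
  shows "distributive_lattice (ideal_order S) \<and>
         (\<forall>I\<in>ideals S. \<forall>J\<in>ideals S.
            I \<squnion>\<^bsub>ideal_order S\<^esub> J = I <+>\<^bsub>S\<^esub> J \<and>
            I \<sqinter>\<^bsub>ideal_order S\<^esub> J = I \<inter> J)"
proof -
  interpret strongly_subtractive_semiring S by (rule assms)
  show ?thesis
    by (simp add: distributive_lattice_ideal_order join_ideal_order meet_ideal_order ideals_def)
qed

end
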